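(* Let $M,N,P\in\mathbb{R}^{d\times d}$ be arbitrary real matrices and let $Q,R\in\mathrm{GL}(d,\mathbb{R})$. Set $$A=\begin{pmatrix} Q^{\#}N^{\top}M & Q^{\#}\\ R\left(Q^{\#}N^{\top}M-P\right) & RQ^{\#}\end{pmatrix}\in\mathbb{R}^{2d\times 2d}.$$ Then $A$ is right-regular and, for all $f,g\in M^1(\mathbb{R}^d)$ and all $x,\omega\in\mathbb{R}^d$, $$\mathcal{B}_A(f,g)(x,\omega)=|\det Q|\,e^{2\pi i\, Mx\cdot N\omega}\,V_{g\circ R}f(Px,Q\omega).$$
   Context: For an invertible matrix $Q$, $Q^{\#}=(Q^{-1})^{\top}$. A block matrix $A=\begin{pmatrix} A_{11} & A_{12} \\ A_{21} & A_{22} \end{pmatrix}\in\mathbb{R}^{2d\times 2d}$ with $d\times d$ blocks is called right-regular if $A_{12}$ and $A_{22}$ are both invertible. The short-time Fourier transform of $f$ with window $h$ is $V_hf(x,\omega)=\int_{\mathbb{R}^d}f(y)\,\overline{h(y-x)}\,e^{-2\pi i y\cdot\omega}\,dy$. The Feichtinger algebra $M^1(\mathbb{R}^d)$ is the space of tempered distributions $f$ with $V_\varphi f\in L^1(\mathbb{R}^{2d})$ for some (equivalently any) nonzero Schwartz window $\varphi$. The matrix-Wigner distribution associated with $A$ is $$\mathcal{B}_A(f,g)(x,\omega)=\int_{\mathbb{R}^d}e^{-2\pi i\omega\cdot y}f(A_{11}x+A_{12}y)\,\overline{g(A_{21}x+A_{22}y)}\,dy ,$$ where the integral converges absolutely for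 $f,g\in M^1(\mathbb{R}^d)$ when $A$ is right-regular. Here $g\circ R$ denotes the function $t\mapsto g(Rt)$. *)

theory Defs
  imports "HOL-Analysis.Analysis"
begin

subsection \<open>Matrices\<close>

definition mat_sharp :: "real ^ 'd ^ 'd \<Rightarrow> real ^ 'd ^ 'd" where
  "mat_sharp Q = transpose (matrix_inv Q)"

text \<open>A \<open>2d \<times> 2d\<close> matrix is indexed by \<open>'d + 'd\<close>: \<open>Inl\<close> selects the first and \<open>Inr\<close> the
  second group of \<open>d\<close> rows or columns.\<close>

definition block_matrix ::
    "real ^ 'd ^ 'd \<Rightarrow> real ^ 'd ^ 'd \<Rightarrow> real ^ 'd ^ 'd \<Rightarrow> real ^ 'd ^ 'd \<Rightarrow>
      real ^ ('d::finite + 'd) ^ ('d + 'd)" where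
  "block_matrix B11 B12 B21 B22 =
    (\<chi> i j. case i of
       Inl k \<Rightarrow> (case j of Inl l \<Rightarrow> B11 $ k $ l | Inr l \<Rightarrow> B12 $ k $ l)
     | Inr k \<Rightarrow> (case j of Inl l \<Rightarrow> B21 $ k $ l | Inr l \<Rightarrow> B22 $ k $ l))"

definition block11 :: "real ^ ('d::finite + 'd) ^ ('d + 'd) \<Rightarrow> real ^ 'd ^ 'd" where
  "block11 A = (\<chi> k l. A $ Inl k $ Inl l)"

definition block12 :: "real ^ ('d::finite + 'd) ^ ('d + 'd) \<Rightarrow> real ^ 'd ^ 'd" where
  "block12 A = (\<chi> k l. A $ Inl k $ Inr l)"

definition block21 :: "real ^ ('d::finite + 'd) ^ ('d + 'd) \<Rightarrow> real ^ 'd ^ 'd" where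
  "block21 A = (\<chi> k l. A $ Inr k $ Inl l)"

definition block22 :: "real ^ ('d::finite + 'd) ^ ('d + 'd) \<Rightarrow> real ^ 'd ^ 'd" where
  "block22 A = (\<chi> k l. A $ Inr k $ Inr l)"

lemma block_of_block_matrix [simp]:
  "block11 (block_matrix B11 B12 B21 B22) = B11"
  "block12 (block_matrix B11 B12 B21 B22) = B12"
  "block21 (block_matrix B11 B12 B21 B22) = B21"
  "block22 (block_matrix B11 B12 B21 B22) = B22"
  by (simp_all add: block_matrix_def block11_def block12_def block21_def block22_def vec_eq_iff)

definition right_regular :: "real ^ ('d::finite + 'd) ^ ('d + 'd) \<Rightarrow> bool" where
  "right_regular A \<longleftrightarrow> invertible (block12 A) \<and> invertible (block22 A)"

subsection \<open>Schwartz functions and tempered distributions\<close>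

definition partial_deriv :: "'d::finite \<Rightarrow> (real ^ 'd \<Rightarrow> complex) \<Rightarrow> real ^ 'd \<Rightarrow> complex" where
  "partial_deriv i f x = vector_derivative (\<lambda>t. f (x + t *\<^sub>R axis i 1)) (at 0)"

primrec partial_derivs ::
    "'d::finite list \<Rightarrow> (real ^ 'd \<Rightarrow> complex) \<Rightarrow> real ^ 'd \<Rightarrow> complex" where
  "partial_derivs [] f = f"
| "partial_derivs (i # is) f = partial_deriv i (partial_derivs is f)"

text \<open>Requiring every iterated partial derivative to be totally differentiable makes all of them
  continuous, so this is \<open>C\<^sup>\<infinity>\<close>; the order of differentiation in a list is then irrelevant.\<close>

definition smooth :: "(real ^ 'd::finite \<Rightarrow> complex) \<Rightarrow> bool" where
  "smooth f \<longleftrightarrow> (\<forall>is. partial_derivs is f differentiable_on UNIV)"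

definition schwartz :: "(real ^ 'd::finite \<Rightarrow> complex) set" where
  "schwartz =
    {f. smooth f \<and> (\<forall>k is. bounded (range (\<lambda>x. norm x ^ k *\<^sub>R partial_derivs is f x)))}"

definition schwartz_seminorm ::
    "nat \<Rightarrow> 'd::finite list \<Rightarrow> (real ^ 'd \<Rightarrow> complex) \<Rightarrow> real" where
  "schwartz_seminorm k is f = (SUP x. norm x ^ k * norm (partial_derivs is f x))"

text \<open>Complex linear functionals on the Schwartz space that are bounded by finitely many
  seminorms, which is continuity for the Frechet topology. The values of \<open>T\<close> outside
  \<open>schwartz\<close> are irrelevant.\<close>

definition tempered_distribution ::
    "((real ^ 'd::finite \<Rightarrow> complex) \<Rightarrow> complex) \<Rightarrow> bool" where
  "tempered_distribution T \<longleftrightarrow>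
    (\<forall>\<phi>\<in>schwartz. \<forall>\<psi>\<in>schwartz. T (\<lambda>y. \<phi> y + \<psi> y) = T \<phi> + T \<psi>) \<and>
    (\<forall>c. \<forall>\<phi>\<in>schwartz. T (\<lambda>y. c * \<phi> y) = c * T \<phi>) \<and>
    (\<exists>C m. \<forall>\<phi>\<in>schwartz.
      norm (T \<phi>) \<le> C * (\<Sum>k\<le>m. \<Sum>is | length is \<le> m. schwartz_seminorm k is \<phi>))"

subsection \<open>Short-time Fourier transform and the Feichtinger algebra\<close>

definition stft ::
    "(real ^ 'd::finite \<Rightarrow> complex) \<Rightarrow> (real ^ 'd \<Rightarrow> complex) \<Rightarrow> real ^ 'd \<Rightarrow> real ^ 'd \<Rightarrow> complex"
  where
  "stft h f x \<omega> =
    (\<integral>y. f y * cnj (h (y - x)) * exp (- 2 * of_real pi * \<i> * of_real (y \<bullet> \<omega>)) \<partial>lborel)"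

text \<open>The integral above read as the (bilinear) pairing of a distribution with the Schwartz
  function by which \<open>f\<close> is multiplied there.\<close>

definition stft_distribution ::
    "(real ^ 'd::finite \<Rightarrow> complex) \<Rightarrow> ((real ^ 'd \<Rightarrow> complex) \<Rightarrow> complex) \<Rightarrow>
      real ^ 'd \<Rightarrow> real ^ 'd \<Rightarrow> complex" where
  "stft_distribution \<phi> T x \<omega> =
    T (\<lambda>y. cnj (\<phi> (y - x)) * exp (- 2 * of_real pi * \<i> * of_real (y \<bullet> \<omega>)))"

definition M1_distributions :: "((real ^ 'd::finite \<Rightarrow> complex) \<Rightarrow> complex) set" where
  "M1_distributions =
    {T. tempered_distribution T \<and>
        (\<exists>\<phi>\<in>schwartz. \<phi> \<noteq> (\<lambda>_. 0) \<and>
          integrable (lborel :: ((real ^ 'd) \<times> (real ^ 'd)) measure)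
            (\<lambda>(x, \<omega>). stft_distribution \<phi> T x \<omega>))}"

definition represents ::
    "(real ^ 'd::finite \<Rightarrow> complex) \<Rightarrow> ((real ^ 'd \<Rightarrow> complex) \<Rightarrow> complex) \<Rightarrow> bool" where
  "represents f T \<longleftrightarrow>
    (\<forall>\<phi>\<in>schwartz. integrable lborel (\<lambda>y. f y * \<phi> y) \<and> T \<phi> = (\<integral>y. f y * \<phi> y \<partial>lborel))"

text \<open>Every distribution in the Feichtinger algebra is given by a unique continuous function;
  the algebra is identified with the set of these functions, so that point evaluation makes
  sense.\<close>

definition M1 :: "(real ^ 'd::finite \<Rightarrow> complex) set" where
  "M1 = {f. continuous_on UNIV f \<and> (\<exists>T\<in>M1_distributions. represents f T)}"

subsection \<open>Matrix-Wigner distributions\<close>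

definition matrix_wigner ::
    "real ^ ('d::finite + 'd) ^ ('d + 'd) \<Rightarrow> (real ^ 'd::finite \<Rightarrow> complex) \<Rightarrow> (real ^ 'd \<Rightarrow> complex) \<Rightarrow>
      real ^ 'd \<Rightarrow> real ^ 'd \<Rightarrow> complex" where
  "matrix_wigner A f g x \<omega> =
    (\<integral>y. exp (- 2 * of_real pi * \<i> * of_real (\<omega> \<bullet> y)) *
          f (block11 A *v x + block12 A *v y) *
          cnj (g (block21 A *v x + block22 A *v y)) \<partial>lborel)"

end

theory Submission
  imports Defs
begin

text \<open>With \<open>s = Q\<^sup># N\<^sup>T M x + Q\<^sup># y\<close> the arguments of \<open>f\<close> and \<open>g\<close> become \<open>s\<close> and \<open>R (s - P x)\<close>,
  while \<open>\<omega> \<bullet> y = s \<bullet> Q \<omega> - M x \<bullet> N \<omega>\<close> because \<open>Q\<^sup>T Q\<^sup># = 1\<close>; the Jacobian is \<open>\<bar>det Q\<bar>\<close>.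
  The library states the linear change of variables only for well-ordered index types, so it is
  derived here for arbitrary finite ones by decomposing matrices into elementary factors.\<close>

section \<open>Shears and coordinate swaps preserve Lebesgue measure\<close>

lemma measure_lebesgue_shear_cbox:
  fixes a b :: "real ^ 'n"
  assumes "m \<noteq> n"
  defines "f \<equiv> \<lambda>x :: real ^ 'n. \<chi> i. if i = m then x $ m + x $ n else x $ i"
  shows "measure lebesgue (f ` cbox a b) = measure lebesgue (cbox a b)"
proof (cases "cbox a b = {}")
  case False
  \<comment> \<open>\<open>measure_shear_interval\<close> asks for a box whose lower corner has a
    nonnegative \<open>n\<close>-th coordinate. Translating by \<open>t\<close> makes this
    coordinate 0, and additivity of \<open>f\<close> turns the translation of the box into a
    translation of its image.\<close>
  define t :: "real ^ 'n" where "t = (\<chi> i. - a $ n)"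
  have f_plus: "f (x + y) = f x + f y" for x y
    by (simp add: f_def vec_eq_iff)
  have box: "cbox (t + a) (t + b) = (+) t ` cbox a b"
    by (simp add: cbox_translation)
  have "f ` cbox (t + a) (t + b) = (+) (f t) ` f ` cbox a b"
    by (simp add: box image_image f_plus)
  moreover have "measure lebesgue (f ` cbox (t + a) (t + b)) = measure lebesgue (cbox (t + a) (t + b))"
    unfolding f_def by (rule measure_shear_interval) (use assms False box in \<open>auto simp: t_def\<close>)
  ultimately show ?thesis
    by (simp add: box measure_translation)
qed auto

lemma lborel_distr_shear:
  fixes f :: "real ^ 'n \<Rightarrow> real ^ 'n"
  assumes "m \<noteq> n"
  defines "f \<equiv> \<lambda>x. \<chi> i. if i = m then x $ m + x $ n else x $ i"
  shows "distr lborel borel f = lborel"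
proof -
  define g :: "real ^ 'n \<Rightarrow> real ^ 'n"
    where "g = (\<lambda>x. \<chi> i. if i = m then x $ m - x $ n else x $ i)"
  have lin: "linear f" "linear g"
    unfolding f_def g_def by (auto intro!: linearI simp: vec_eq_iff algebra_simps)
  have meas: "f \<in> borel_measurable borel" "g \<in> borel_measurable borel"
    using lin by (auto intro!: borel_measurable_continuous_onI linear_continuous_on simp: linear_conv_bounded_linear)
  have gf: "g (f x) = x" and fg: "f (g x) = x" for x
    using assms(1) by (auto simp: f_def g_def vec_eq_iff)
  \<comment> \<open>The inverse shear \<open>g\<close> comes first because its preimage of a box is
    the image of that box under \<open>f\<close>, whose measure is accessible.\<close>
  have "lborel = distr lborel borel g"
  proof (rule lborel_eqI)
    fix l u :: "real ^ 'n"
    assume lu: "\<And>b. b \<in> Basis \<Longrightarrow> l \<bullet> b \<le> u \<bullet> b"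
    have vimage: "g -` box l u = f ` box l u"
      by (auto simp: gf image_iff intro!: bexI[of _ "g _"] fg[symmetric])
    have borel: "g -` box l u \<in> sets borel"
      using measurable_sets_borel[OF meas(2)] by simp
    \<comment> \<open>A linear map that scales all closed boxes by a common factor, here 1, scales
      every set of finite Lebesgue measure by that factor, in particular an open box.\<close>
    have "f ` box l u \<in> lmeasurable \<and> 1 * measure lebesgue (box l u) = measure lebesgue (f ` box l u)"
      using lin(1) by (intro measure_linear_sufficient)
        (simp_all add: f_def measure_lebesgue_shear_cbox[OF assms(1)])
    then have "emeasure lebesgue (f ` box l u) = emeasure lebesgue (box l u)"
      by (simp add: emeasure_eq_measure2)
    then have "emeasure lborel (g -` box l u) = emeasure lborel (box l u)"
      using borel by (simp add: vimage)
    then show "emeasure (distr lborel borel g) (box l u) = (\<Prod>b\<in>Basis. (u - l) \<bullet> b)"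
      using lu meas by (simp add: emeasure_distr emeasure_lborel_box)
  qed simp
  \<comment> \<open>Pushing forward along \<open>g\<close> and then along \<open>f\<close> is
    pushing forward along the identity.\<close>
  then have "distr lborel borel f = distr (distr lborel borel g) borel f"
    by simp
  also have "\<dots> = lborel"
    using meas by (simp add: distr_distr o_def fg distr_id2)
  finally show ?thesis .
qed

text \<open>A swap is its own inverse, so the preimage of a box is the box with swapped corners, and
  reordering the side lengths keeps their product.\<close>

lemma lborel_distr_coordinate_transpose:
  "distr lborel borel (\<lambda>x :: real ^ 'n. \<chi> i. x $ Transposition.transpose m n i) = lborel"
    (is "distr _ _ ?f = _")
proof (rule lborel_eqI[symmetric])
  fix l u :: "real ^ 'n"
  assume lu: "\<And>b. b \<in> Basis \<Longrightarrow> l \<bullet> b \<le> u \<bullet> b"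
  have le: "l $ i \<le> u $ i" for i
    using lu[of "axis i 1"] by (simp add: inner_axis axis_in_Basis_iff)
  have lin: "linear ?f"
    by (auto intro!: linearI simp: vec_eq_iff)
  then have meas: "?f \<in> borel_measurable borel"
    by (auto intro!: borel_measurable_continuous_onI linear_continuous_on simp: linear_conv_bounded_linear)
  have "?f -` box l u = box (?f l) (?f u)"
    by (auto simp: mem_box_cart) (metis transpose_involutory)+
  moreover have "emeasure lborel (box (?f l) (?f u)) = (\<Prod>b\<in>Basis. (?f u - ?f l) \<bullet> b)"
    by (rule emeasure_lborel_box) (auto simp: Basis_vec_def inner_axis le)
  moreover have "(\<Prod>b\<in>Basis. (?f u - ?f l) \<bullet> b) = (\<Prod>b\<in>Basis. (u - l) \<bullet> b)"
  proof -
    have cart: "(\<Prod>b\<in>Basis. v \<bullet> b) = (\<Prod>i\<in>UNIV. v $ i)" for v :: "real ^ 'n"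
    proof -
      have B: "(Basis :: (real ^ 'n) set) = range (\<lambda>i. axis i 1)"
        by (auto simp: Basis_vec_def)
      show ?thesis
        unfolding B by (subst prod.reindex) (auto simp: inj_on_def axis_eq_axis inner_axis)
    qed
    have "(\<Prod>i\<in>UNIV. (u - l) $ Transposition.transpose m n i) = (\<Prod>i\<in>UNIV. (u - l) $ i)"
      by (rule prod.reindex_bij_betw[of "Transposition.transpose m n" UNIV UNIV "\<lambda>i. (u - l) $ i"]) simp
    then show ?thesis
      by (simp add: cart)
  qed
  ultimately show "emeasure (distr lborel borel ?f) (box l u) = (\<Prod>b\<in>Basis. (u - l) \<bullet> b)"
    using meas by (simp add: emeasure_distr)
qed simp

section \<open>Change of variables for invertible matrices\<close>

lemma measurable_matrix_vector_mult [measurable]: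
  "(\<lambda>x. A *v x) \<in> borel_measurable borel" for A :: "real ^ 'n ^ 'm"
  by (intro borel_measurable_continuous_onI linear_continuous_on) simp

text \<open>The formula is multiplicative in the matrix, so elementary factors suffice: diagonal
  matrices rescale the axes, while swaps and shears preserve the measure.\<close>

lemma nn_integral_lborel_matrix:
  fixes A :: "real ^ 'n ^ 'n"
  assumes "invertible A" and "F \<in> borel_measurable borel"
  shows "(\<integral>\<^sup>+x. F x \<partial>lborel) = ennreal \<bar>det A\<bar> * (\<integral>\<^sup>+y. F (A *v y) \<partial>lborel)"
proof -
  \<comment> \<open>The determinant condition sits inside the property because the induction ranges
    over singular matrices too; a zero row then makes it vacuous. Quantifying over \<open>F\<close>
    lets the product case apply the formula for \<open>B\<close> to
    \<open>\<lambda>y. F (A *v y)\<close>.\<close>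
  let ?P = "\<lambda>A :: real ^ 'n ^ 'n. det A \<noteq> 0 \<longrightarrow> (\<forall>F \<in> borel_measurable borel.
      (\<integral>\<^sup>+x. F x \<partial>lborel) = ennreal \<bar>det A\<bar> * (\<integral>\<^sup>+y. F (A *v y) \<partial>lborel))"
  have isometry: "?P A" if "\<bar>det A\<bar> = 1" "distr lborel borel (\<lambda>x. A *v x) = lborel" for A
  proof (intro impI ballI)
    fix F :: "real ^ 'n \<Rightarrow> ennreal"
    assume [measurable]: "F \<in> borel_measurable borel"
    have "(\<integral>\<^sup>+x. F x \<partial>lborel) = (\<integral>\<^sup>+x. F x \<partial>distr lborel borel (\<lambda>x. A *v x))"
      by (simp add: that)
    also have "\<dots> = (\<integral>\<^sup>+y. F (A *v y) \<partial>lborel)"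
      by (rule nn_integral_distr) simp_all
    finally show "(\<integral>\<^sup>+x. F x \<partial>lborel) = ennreal \<bar>det A\<bar> * (\<integral>\<^sup>+y. F (A *v y) \<partial>lborel)"
      by (simp add: that)
  qed
  have "?P A"
  proof (induction A rule: induct_matrix_elementary_alt)
    case (1 A B)
    show ?case
    proof (intro impI ballI)
      fix F :: "real ^ 'n \<Rightarrow> ennreal"
      assume "det (A ** B) \<noteq> 0" and F [measurable]: "F \<in> borel_measurable borel"
      then have nz: "det A \<noteq> 0" "det B \<noteq> 0"
        by (auto simp: det_mul)
      have meas: "(\<lambda>y. F (A *v y)) \<in> borel_measurable borel"
        by measurable
      have "(\<integral>\<^sup>+x. F x \<partial>lborel) = ennreal \<bar>det A\<bar> * (\<integral>\<^sup>+y. F (A *v y) \<partial>lborel)"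
        using 1(1) nz(1) F by blast
      also have "(\<integral>\<^sup>+y. F (A *v y) \<partial>lborel) =
          ennreal \<bar>det B\<bar> * (\<integral>\<^sup>+y. F (A *v (B *v y)) \<partial>lborel)"
        using 1(2) nz(2) meas by blast
      finally show "(\<integral>\<^sup>+x. F x \<partial>lborel) =
          ennreal \<bar>det (A ** B)\<bar> * (\<integral>\<^sup>+y. F ((A ** B) *v y) \<partial>lborel)"
        by (simp add: det_mul abs_mult ennreal_mult mult.assoc matrix_vector_mul_assoc)
    qed
  next
    case (2 A i)
    then show ?case
      using det_zero_row(1)[of i A] by simp
  next
    case (3 A)
    show ?case
    proof (intro impI ballI)
      fix F :: "real ^ 'n \<Rightarrow> ennreal"
      assume nz: "det A \<noteq> 0" and F [measurable]: "F \<in> borel_measurable borel"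
      have det: "det A = (\<Prod>i\<in>UNIV. A $ i $ i)"
        using 3 by (rule det_diagonal)
      \<comment> \<open>The diagonal of \<open>A\<close> recast as a function on
        \<open>Basis\<close>, the form in which \<open>lborel_affine_euclidean\<close> takes its
        scaling factors.\<close>
      define c where "c = (\<lambda>b. (\<Sum>i\<in>UNIV. A $ i $ i *\<^sub>R axis i 1) \<bullet> (b :: real ^ 'n))"
      have c: "c (axis i 1) = A $ i $ i" for i
        by (simp add: c_def inner_sum_left inner_axis_axis if_distrib cong: if_cong)
      have B: "(Basis :: (real ^ 'n) set) = range (\<lambda>i. axis i 1)"
        by (auto simp: Basis_vec_def)
      have sum_B: "(\<Sum>b\<in>Basis. G b) = (\<Sum>i\<in>UNIV. G (axis i 1))"
        for G :: "real ^ 'n \<Rightarrow> real ^ 'n"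
        unfolding B by (subst sum.reindex) (auto simp: inj_on_def axis_eq_axis)
      have prod_B: "(\<Prod>b\<in>Basis. G b) = (\<Prod>i\<in>UNIV. G (axis i 1))" for G :: "real ^ 'n \<Rightarrow> real"
        unfolding B by (subst prod.reindex) (auto simp: inj_on_def axis_eq_axis)
      have A: "A *v x = 0 + (\<Sum>b\<in>Basis. (c b * (x \<bullet> b)) *\<^sub>R b)" for x
      proof -
        have "(A *v x) $ j = (0 + (\<Sum>b\<in>Basis. (c b * (x \<bullet> b)) *\<^sub>R b)) $ j" for j
        proof -
          have "(\<Sum>i\<in>UNIV. A $ j $ i * x $ i) = (\<Sum>i\<in>UNIV. if i = j then A $ j $ j * x $ j else 0)"
            by (rule sum.cong) (auto simp: 3)
          then have "(A *v x) $ j = A $ j $ j * x $ j"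
            by (simp add: matrix_vector_mult_def)
          also have "\<dots> = (0 + (\<Sum>b\<in>Basis. (c b * (x \<bullet> b)) *\<^sub>R b)) $ j"
            by (simp add: sum_B c inner_axis) (simp add: axis_def if_distrib[of "\<lambda>z. _ * z"] cong: if_cong)
          finally show ?thesis .
        qed
        then show ?thesis
          unfolding vec_eq_iff by blast
      qed
      have prod: "(\<Prod>b\<in>Basis. \<bar>c b\<bar>) = \<bar>det A\<bar>"
        by (simp add: prod_B c det abs_prod)
      have "c b \<noteq> 0" if "b \<in> Basis" for b
        using that nz by (auto simp: B c det)
      then have "lborel = density (distr lborel borel (\<lambda>x. A *v x)) (\<lambda>_. \<bar>det A\<bar>)"
        unfolding A prod[symmetric] by (rule lborel_affine_euclidean[where t = 0])
      then have "(\<integral>\<^sup>+x. F x \<partial>lborel) =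
          (\<integral>\<^sup>+x. F x \<partial>density (distr lborel borel (\<lambda>x. A *v x)) (\<lambda>_. \<bar>det A\<bar>))"
        by simp
      also have "\<dots> = ennreal \<bar>det A\<bar> * (\<integral>\<^sup>+y. F (A *v y) \<partial>lborel)"
        by (simp add: nn_integral_density nn_integral_distr nn_integral_cmult)
      finally show "(\<integral>\<^sup>+x. F x \<partial>lborel) = ennreal \<bar>det A\<bar> * (\<integral>\<^sup>+y. F (A *v y) \<partial>lborel)" .
    qed
  next
    case (4 m n)
    let ?A = "(\<chi> i j. mat 1 $ i $ Transposition.transpose m n j) :: real ^ 'n ^ 'n"
    have eq: "?A *v x = (\<chi> i. x $ Transposition.transpose m n i)" for x
    proof -
      have "(\<Sum>j\<in>UNIV. (if i = Transposition.transpose m n j then 1 else 0) * x $ j) =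
        x $ Transposition.transpose m n i" for i
      proof -
        \<comment> \<open>Moving the involution to the other side isolates \<open>j\<close>, so the
          sum over \<open>j\<close> collapses to one term.\<close>
        have "i = Transposition.transpose m n j \<longleftrightarrow> j = Transposition.transpose m n i" for j
          by (metis transpose_involutory)
        then show ?thesis
          by (simp add: if_distrib[of "\<lambda>z. z * _"] cong: if_cong)
      qed
      then show ?thesis
        by (simp add: matrix_vector_mult_def mat_def vec_eq_iff)
    qed
    have "\<bar>det ?A\<bar> = 1"
      using 4 by (simp add: det_permute_columns permutes_swap_id sign_swap_id)
    then show ?case
      by (intro isometry) (simp_all add: eq lborel_distr_coordinate_transpose)
  next
    case (5 m n)
    let ?A = "(\<chi> i j. of_bool (i = m \<and> j = n \<or> i = j)) :: real ^ 'n ^ 'n"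
    have eq: "?A *v x = (\<chi> i. if i = m then x $ m + x $ n else x $ i)" for x
    proof -
      \<comment> \<open>As \<open>m\<close> and \<open>n\<close> differ, the two conditions for an
        entry 1 exclude each other, and the row sum splits in two.\<close>
      have "(?A *v x) $ i = (\<Sum>j\<in>UNIV. (if j = i then x $ i else 0) + (if j = n \<and> i = m then x $ n else 0))" for i
        unfolding matrix_vector_mult_def using 5 by (auto intro!: sum.cong)
      then show ?thesis
        by (auto simp: vec_eq_iff sum.distrib)
    qed
    \<comment> \<open>The shear matrix arises from the identity by adding row \<open>n\<close> to
      row \<open>m\<close>, which keeps the determinant.\<close>
    have "?A = (\<chi> k. if k = m then row m (mat 1) + 1 *s row n (mat 1) else row k (mat 1))"
      using 5 by (auto simp: vec_eq_iff row_def mat_def)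
    then have "\<bar>det ?A\<bar> = 1"
      by (simp only: det_row_operation[OF 5] det_I abs_one)
    moreover have "distr lborel borel (\<lambda>x. ?A *v x) = lborel"
      unfolding eq by (rule lborel_distr_shear[OF 5])
    ultimately show ?case
      by (rule isometry)
  qed
  with assms show ?thesis
    unfolding invertible_det_nz by blast
qed

text \<open>Indicator functions in the previous formula give an equality of measures, which carries
  it over to Bochner integrals.\<close>

lemma lborel_eq_density_distr_matrix:
  fixes A :: "real ^ 'n ^ 'n"
  assumes "invertible A"
  shows "lborel = density (distr lborel borel (\<lambda>x. A *v x)) (\<lambda>_. ennreal \<bar>det A\<bar>)"
proof (rule measure_eqI)
  fix X :: "(real ^ 'n) set"
  assume "X \<in> sets lborel"
  then have [measurable]: "X \<in> sets borel"
    by simp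
  have "emeasure lborel X = (\<integral>\<^sup>+x. indicator X x \<partial>lborel)"
    by simp
  also have "\<dots> = ennreal \<bar>det A\<bar> * (\<integral>\<^sup>+y. indicator X (A *v y) \<partial>lborel)"
    by (rule nn_integral_lborel_matrix[OF assms]) simp
  also have "(\<integral>\<^sup>+y. indicator X (A *v y) \<partial>lborel) = emeasure (distr lborel borel (\<lambda>x. A *v x)) X"
    using nn_integral_distr[of "\<lambda>x. A *v x" lborel borel "indicator X"] by simp
  also have "ennreal \<bar>det A\<bar> * \<dots> =
      emeasure (density (distr lborel borel (\<lambda>x. A *v x)) (\<lambda>_. ennreal \<bar>det A\<bar>)) X"
    by (simp add: emeasure_density nn_integral_cmult)
  finally show "emeasure lborel X =
    emeasure (density (distr lborel borel (\<lambda>x. A *v x)) (\<lambda>_. ennreal \<bar>det A\<bar>)) X" .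
qed simp

text \<open>Translation invariance handles \<open>a\<close>, and the density formula handles
  \<open>A\<close>. For a nonintegrable \<open>F\<close> both integrals take the default value
  0.\<close>

lemma integral_lborel_matrix_affine:
  fixes A :: "real ^ 'n ^ 'n" and F :: "real ^ 'n \<Rightarrow> 'b :: {banach, second_countable_topology}"
  assumes "invertible A" and F [measurable]: "F \<in> borel_measurable borel"
  shows "(\<integral>x. F x \<partial>lborel) = \<bar>det A\<bar> *\<^sub>R (\<integral>y. F (a + A *v y) \<partial>lborel)"
proof -
  have "(\<integral>x. F x \<partial>lborel) = (\<integral>x. F x \<partial>distr lborel borel ((+) a))"
    by (simp add: lborel_distr_plus)
  also have "\<dots> = (\<integral>x. F (a + x) \<partial>lborel)"
    by (simp add: integral_distr)
  also have "\<dots> = (\<integral>x. F (a + x) \<partial>density (distr lborel borel (\<lambda>x. A *v x)) (\<lambda>_. ennreal \<bar>det A\<bar>))"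
    by (subst lborel_eq_density_distr_matrix[OF assms(1)]) simp
  also have "\<dots> = \<bar>det A\<bar> *\<^sub>R (\<integral>y. F (a + A *v y) \<partial>lborel)"
    by (simp add: integral_density integral_distr)
  finally show ?thesis .
qed

section \<open>Algebra of the inverse transpose\<close>

lemma matrix_inv_inverse:
  assumes "invertible A"
  shows "A ** matrix_inv A = mat 1" "matrix_inv A ** A = mat 1"
  using someI_ex[OF assms[unfolded invertible_def]] by (simp_all add: matrix_inv_def)

text \<open>Transposing \<open>matrix_inv Q ** Q = mat 1\<close> gives the first identity; its
  determinant gives the other two claims.\<close>

lemma
  fixes Q :: "real ^ 'n ^ 'n"
  assumes "invertible Q"
  shows transpose_mult_mat_sharp: "transpose Q ** mat_sharp Q = mat 1"
    and invertible_mat_sharp: "invertible (mat_sharp Q)"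
    and det_mat_sharp: "det (mat_sharp Q) = inverse (det Q)"
proof -
  show eq: "transpose Q ** mat_sharp Q = mat 1"
    by (metis mat_sharp_def matrix_inv_inverse(2)[OF assms] matrix_transpose_mul transpose_mat)
  have "det Q * det (mat_sharp Q) = 1"
    using arg_cong[OF eq, of det] by (simp add: det_mul)
  then show "det (mat_sharp Q) = inverse (det Q)" "invertible (mat_sharp Q)"
    by (auto simp: inverse_unique invertible_det_nz)
qed

section \<open>The matrix-Wigner identity\<close>

lemma continuous_on_M1: "f \<in> M1 \<Longrightarrow> continuous_on UNIV f"
  by (simp add: M1_def)

theorem theorem3:
  fixes M N P Q R :: "real ^ 'd ^ 'd"
    and A :: "real ^ ('d + 'd) ^ ('d + 'd)"
  assumes "invertible Q" and "invertible R"
    and "A = block_matrix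
          (mat_sharp Q ** transpose N ** M) (mat_sharp Q)
          (R ** (mat_sharp Q ** transpose N ** M - P)) (R ** mat_sharp Q)"
  shows "right_regular A \<and>
    (\<forall>f\<in>M1. \<forall>g\<in>M1. \<forall>x \<omega>.
      matrix_wigner A f g x \<omega> =
        of_real \<bar>det Q\<bar> * exp (2 * of_real pi * \<i> * of_real ((M *v x) \<bullet> (N *v \<omega>))) *
        stft (\<lambda>t. g (R *v t)) f (P *v x) (Q *v \<omega>))"
proof (intro conjI ballI allI)
  show "right_regular A"
    using assms by (simp add: right_regular_def invertible_mat_sharp invertible_mult)
next
  fix f g :: "real ^ 'd \<Rightarrow> complex" and x \<omega> :: "real ^ 'd"
  assume "f \<in> M1" "g \<in> M1"
  then have cont: "continuous_on UNIV f" "continuous_on UNIV g"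
    by (simp_all add: continuous_on_M1)
  define S a where "S = mat_sharp Q" and "a = (S ** transpose N ** M) *v x"
  let ?phase = "exp (2 * of_real pi * \<i> * of_real ((M *v x) \<bullet> (N *v \<omega>)))"
  \<comment> \<open>The integrand of the short-time Fourier transform in the variable
    \<open>s\<close>, to be substituted by \<open>a + S *v y\<close>.\<close>
  let ?F = "\<lambda>s. f s * cnj (g (R *v (s - P *v x))) *
    exp (- 2 * of_real pi * \<i> * of_real (s \<bullet> (Q *v \<omega>)))"
  have "continuous_on UNIV (\<lambda>s. g (R *v (s - P *v x)))"
    by (intro continuous_on_compose2[OF cont(2)] continuous_intros subset_UNIV
        continuous_on_compose2[OF matrix_vector_mult_linear_continuous_on[of UNIV R]])
  then have "?F \<in> borel_measurable borel"
    by (intro borel_measurable_continuous_onI continuous_intros cont)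
  then have "stft (\<lambda>t. g (R *v t)) f (P *v x) (Q *v \<omega>) = \<bar>det S\<bar> *\<^sub>R (\<integral>y. ?F (a + S *v y) \<partial>lborel)"
    unfolding stft_def S_def
    by (rule integral_lborel_matrix_affine[OF invertible_mat_sharp[OF assms(1)]])
  moreover have "det Q \<noteq> 0"
    using assms(1) by (simp add: invertible_det_nz)
  \<comment> \<open>The Jacobian \<open>\<bar>det S\<bar>\<close> is the reciprocal of
    \<open>\<bar>det Q\<bar>\<close>, so the prefactor cancels it.\<close>
  ultimately have stft: "of_real \<bar>det Q\<bar> * stft (\<lambda>t. g (R *v t)) f (P *v x) (Q *v \<omega>) =
      (\<integral>y. ?F (a + S *v y) \<partial>lborel)"
    by (simp add: S_def det_mat_sharp[OF assms(1)] scaleR_conv_of_real abs_inverse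
        flip: mult.assoc of_real_mult)
  have integrand: "exp (- 2 * of_real pi * \<i> * of_real (\<omega> \<bullet> y)) *
      f (block11 A *v x + block12 A *v y) * cnj (g (block21 A *v x + block22 A *v y)) =
      ?phase * ?F (a + S *v y)" for y
  proof -
    have "transpose Q *v (S *v z) = z" for z
      by (simp add: S_def matrix_vector_mul_assoc transpose_mult_mat_sharp[OF assms(1)])
    \<comment> \<open>Moving \<open>Q\<close> across the inner product as its transpose cancels
      \<open>S\<close>.\<close>
    then have S: "(S *v z) \<bullet> (Q *v \<omega>) = z \<bullet> \<omega>" for z
      by (metis dot_lmul_matrix vector_transpose_matrix transpose_matrix_vector transpose_transpose)
    have "a \<bullet> (Q *v \<omega>) = (transpose N *v (M *v x)) \<bullet> \<omega>"
      \<comment> \<open>Read backwards, \<open>S\<close> applies because \<open>a\<close> is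
        \<open>S\<close> applied to \<open>transpose N *v (M *v x)\<close>.\<close>
      unfolding S[symmetric] by (simp add: a_def matrix_vector_mul_assoc matrix_mul_assoc)
    also have "\<dots> = (M *v x) \<bullet> (N *v \<omega>)"
      by (metis dot_lmul_matrix transpose_matrix_vector)
    finally have "(a + S *v y) \<bullet> (Q *v \<omega>) = (M *v x) \<bullet> (N *v \<omega>) + \<omega> \<bullet> y"
      by (simp add: inner_add_left S inner_commute[of y])
    \<comment> \<open>The chirp \<open>?phase\<close> absorbs the part of the exponent coming from
      the shift \<open>a\<close>, leaving the Fourier kernel in \<open>y\<close>.\<close>
    then have "?phase * exp (- 2 * of_real pi * \<i> * of_real ((a + S *v y) \<bullet> (Q *v \<omega>))) =
        exp (- 2 * of_real pi * \<i> * of_real (\<omega> \<bullet> y))"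
      by (simp add: algebra_simps flip: exp_add)
    moreover have "block11 A *v x + block12 A *v y = a + S *v y"
      by (simp add: assms(3) a_def S_def)
    moreover have "block21 A *v x + block22 A *v y = R *v (a + S *v y - P *v x)"
      by (simp add: assms(3) a_def S_def matrix_vector_mult_diff_rdistrib matrix_vector_mult_diff_distrib
          matrix_vector_right_distrib flip: matrix_vector_mul_assoc)
    ultimately show ?thesis
      by (simp add: mult_ac)
  qed
  show "matrix_wigner A f g x \<omega> =
      of_real \<bar>det Q\<bar> * ?phase * stft (\<lambda>t. g (R *v t)) f (P *v x) (Q *v \<omega>)"
    unfolding matrix_wigner_def integrand integral_mult_right_zero stft[symmetric]
    by (simp only: mult_ac)
qed

end
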